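(* There is an absolute constant $C>0$ such that the following holds. Let $0<\varepsilon<1$, let $A$ be a real $n\times d$ matrix, and let $S$ be a sample of $s \ge C/\varepsilon^4$ rows of $A$, each chosen independently according to the length-squared distribution. Then the span of $S$ contains a matrix $\tilde{A}$ of rank $1$ (i.e., there is a rank-$1$ matrix $\tilde{A}$, depending on $S$, all of whose rows lie in the linear span of the rows in $S$) such that \[ \mathbf{E}\big[\|A-\tilde{A}\|_F^2\big] \le (1+\varepsilon)\,\|A-\pi_1(A)\|_F^2 . \]
   Context: For a real $n\times d$ matrix $A$ with rows $A^{(1)},\dots,A^{(n)}$, the length-squared distribution selects row $i$ with probability $p_i=\|A^{(i)}\|^2/\|A\|_F^2$ (Euclidean norm of the row over the squared Frobenius norm of $A$). $\pi_1(A)$ denotes a best rank-$1$ approximation of $A$ in Frobenius norm: $\pi_1(A)=\arg\min_{X:\ \mathrm{rank}(X)\le 1}\|A-X\|_F^2$. The expectation is over the random sample $S$. *)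

theory Defs
  imports "HOL-Probability.Probability" "Jordan_Normal_Form.DL_Rank"
begin

definition vec_norm :: "real Matrix.vec \<Rightarrow> real" where
  "vec_norm v = sqrt (\<Sum>j<dim_vec v. (vec_index v j)\<^sup>2)"

definition frob_norm :: "real mat \<Rightarrow> real" where
  "frob_norm A = sqrt (\<Sum>i<dim_row A. \<Sum>j<dim_col A. (A $$ (i, j))\<^sup>2)"

definition length_squared_prob :: "real mat \<Rightarrow> nat \<Rightarrow> real" where
  "length_squared_prob A i =
     (if i < dim_row A then (vec_norm (Matrix.row A i))\<^sup>2 / (frob_norm A)\<^sup>2 else 0)"

text \<open>A distribution on row indices. It is meaningful only for nonzero \<open>A\<close>; see
  \<open>pmf_length_squared\<close> below.\<close>

definition length_squared_pmf :: "real mat \<Rightarrow> nat pmf" where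
  "length_squared_pmf A = embed_pmf (length_squared_prob A)"

text \<open>\<^const>\<open>vec_space.rank\<close> is the dimension of the column space and takes the dimension of the
  columns as its first argument. The predicate says that \<open>X\<close> is one of the (in general not unique)
  minimisers.\<close>

definition best_rank1_approx :: "real mat \<Rightarrow> real mat \<Rightarrow> bool" where
  "best_rank1_approx A X \<longleftrightarrow>
     is_arg_min (\<lambda>X. (frob_norm (A - X))\<^sup>2)
       (\<lambda>X. X \<in> carrier_mat (dim_row A) (dim_col A) \<and> vec_space.rank (dim_row A) X \<le> 1) X"

definition row_span :: "real mat \<Rightarrow> nat list \<Rightarrow> real Matrix.vec set" where
  "row_span A S =
     LinearCombinations.module.span class_ring (module_vec TYPE(real) (dim_col A))
       (Matrix.row A ` set S)"

lemma vec_norm_sq: "(vec_norm v)\<^sup>2 = (\<Sum>j<dim_vec v. (vec_index v j)\<^sup>2)"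
  by (simp add: vec_norm_def sum_nonneg)

lemma frob_norm_sq: "(frob_norm A)\<^sup>2 = (\<Sum>i<dim_row A. \<Sum>j<dim_col A. (A $$ (i, j))\<^sup>2)"
  by (simp add: frob_norm_def sum_nonneg)

lemma frob_norm_sq_rows: "(frob_norm A)\<^sup>2 = (\<Sum>i<dim_row A. (vec_norm (Matrix.row A i))\<^sup>2)"
  by (simp add: frob_norm_sq vec_norm_sq)

lemma frob_norm_sq_pos:
  assumes "A \<in> carrier_mat n d" "A \<noteq> 0\<^sub>m n d"
  shows "(frob_norm A)\<^sup>2 > 0"
proof (rule ccontr)
  assume "\<not> (frob_norm A)\<^sup>2 > 0"
  then have z: "(\<Sum>i<dim_row A. \<Sum>j<dim_col A. (A $$ (i, j))\<^sup>2) = 0"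
    using frob_norm_sq[of A] by (metis zero_less_power2 power_zero_numeral)
  have "A $$ (i, j) = 0" if "i < n" "j < d" for i j
  proof -
    have "(\<Sum>j<dim_col A. (A $$ (i, j))\<^sup>2) = 0"
      using z that assms by (subst (asm) sum_nonneg_eq_0_iff) (auto intro: sum_nonneg)
    then show ?thesis
      using that assms by (subst (asm) sum_nonneg_eq_0_iff) auto
  qed
  then have "A = 0\<^sub>m n d"
    using assms(1) by (intro eq_matI) auto
  with assms(2) show False by simp
qed

lemma pmf_length_squared:
  assumes "A \<in> carrier_mat n d" "A \<noteq> 0\<^sub>m n d"
  shows "pmf (length_squared_pmf A) i = length_squared_prob A i"
  unfolding length_squared_pmf_def
proof (rule pmf_embed_pmf)
  show nn: "0 \<le> length_squared_prob A i" for i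
    by (simp add: length_squared_prob_def)
  have "(\<integral>\<^sup>+ i. ennreal (length_squared_prob A i) \<partial>count_space UNIV)
      = (\<Sum>i<dim_row A. ennreal (length_squared_prob A i))"
    by (rule nn_integral_count_space') (auto simp: length_squared_prob_def)
  also have "\<dots> = ennreal (\<Sum>i<dim_row A. length_squared_prob A i)"
    using nn by (simp add: sum_ennreal)
  also have "(\<Sum>i<dim_row A. length_squared_prob A i) = (frob_norm A)\<^sup>2 / (frob_norm A)\<^sup>2"
    by (simp add: length_squared_prob_def flip: sum_divide_distrib frob_norm_sq_rows)
  also have "\<dots> = 1"
    using frob_norm_sq_pos[OF assms] by simp
  finally show "(\<integral>\<^sup>+ i. ennreal (length_squared_prob A i) \<partial>count_space UNIV) = 1"
    by simp
qed

end

theory Submission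
  imports Defs
begin

text \<open>
  Write a matrix of rank at most one as \<open>x y\<^sup>T\<close> with \<open>x \<noteq> 0\<close>. For this \<open>x\<close> the best choice of \<open>y\<close> is
  \<open>w = A\<^sup>T x / |x|\<^sup>2\<close>, and \<open>|A - x z\<^sup>T|\<^sup>2 = |A - x w\<^sup>T|\<^sup>2 + |x|\<^sup>2 |z - w|\<^sup>2\<close> for all \<open>z\<close>. Let \<open>z\<close> be the
  average over the sample of the vectors \<open>x\<^sub>k a\<^sub>k / (|x|\<^sup>2 p\<^sub>k)\<close>, where \<open>a\<^sub>k\<close> is the \<open>k\<close>-th row. It is an
  unbiased estimator of \<open>w\<close>, and \<open>p\<^sub>k = |a\<^sub>k|\<^sup>2 / |A|\<^sup>2\<close> makes its variance at most
  \<open>(|A|\<^sup>2 / |x|\<^sup>2 - |w|\<^sup>2) / s = |A - x w\<^sup>T|\<^sup>2 / (s |x|\<^sup>2)\<close>. Hence the expected error of \<open>x z\<^sup>T\<close> is at most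
  \<open>1 + 1/s\<close> times that of \<open>x w\<^sup>T\<close>. If \<open>z\<close> happens to vanish, the rank is repaired by keeping a single
  sampled row of \<open>A\<close>, which does no worse than the zero matrix.
\<close>

section \<open>Outer products and matrices of rank one\<close>

text \<open>The factors are plain functions rather than vectors, so that formulas for coefficients
  can be plugged in directly. Only their values below \<open>n\<close> and \<open>d\<close>
  matter.\<close>

definition outer :: "nat \<Rightarrow> nat \<Rightarrow> (nat \<Rightarrow> real) \<Rightarrow> (nat \<Rightarrow> real) \<Rightarrow> real mat" where
  "outer n d x y = Matrix.mat n d (\<lambda>(i, j). x i * y j)"

lemma outer_carrier [simp]: "outer n d x y \<in> carrier_mat n d"
  by (simp add: outer_def)

lemma frob_norm_sq_minus_outer:
  assumes "A \<in> carrier_mat n d"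
  shows "(frob_norm (A - outer n d x y))\<^sup>2 = (\<Sum>i<n. \<Sum>j<d. (A $$ (i, j) - x i * y j)\<^sup>2)"
  using assms by (simp add: frob_norm_sq outer_def)

lemma (in vec_space) lin_indpt_singleton:
  assumes "v \<in> carrier_vec n" "v \<noteq> 0\<^sub>v n"
  shows "lin_indpt {v}"
  using assms lindep_span[of "{v}"] span_empty by auto

lemma (in vec_space) span_singletonE:
  assumes "w \<in> span {v}" "v \<in> carrier_vec n"
  obtains c where "w = c \<cdot>\<^sub>v v"
proof -
  obtain a where "w = lincomb a {v}"
    using assms finite_span[of "{v}"] by auto
  then have "w = a v \<cdot>\<^sub>v v"
    using assms by (simp add: lincomb_def)
  then show ?thesis
    by (rule that)
qed

text \<open>The product form of the entries bounds the rank from above. Column \<open>j\<close> is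
  nonzero at \<open>i\<close>, hence independent on its own, which bounds it from below.\<close>

lemma rank_eq_one_outer:
  assumes "i < n" "x i \<noteq> 0" "j < d" "y j \<noteq> 0"
  shows "vec_space.rank n (outer n d x y) = 1"
proof -
  interpret vec_space "TYPE(real)" n .
  have "rank (outer n d x y) \<le> 1"
    by (rule rank_le_1_product_entries[of "outer n d x y" d x y]) (auto simp: outer_def)
  moreover have "card {col (outer n d x y) j} \<le> rank (outer n d x y)"
  proof (rule rank_ge_card_indpt[OF outer_carrier])
    show "{col (outer n d x y) j} \<subseteq> set (cols (outer n d x y))"
      using assms by (auto simp: cols_def outer_def)
    have "vec_index (col (outer n d x y) j) i \<noteq> 0"
      using assms by (simp add: outer_def)
    then have nz: "col (outer n d x y) j \<noteq> 0\<^sub>v n"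
      using assms(1) by auto
    have c: "col (outer n d x y) j \<in> carrier_vec n"
      using col_carrier_vec[OF _ outer_carrier] assms(3) by simp
    show "lin_indpt {col (outer n d x y) j}"
      by (rule lin_indpt_singleton[OF c nz])
  qed
  ultimately show ?thesis by simp
qed

text \<open>Two distinct independent columns would force rank 2, so all columns are multiples of one
  nonzero column, which serves as \<open>x\<close>. The nonvanishing of \<open>x\<close> later
  permits division by its squared norm.\<close>

lemma rank_le_oneE:
  assumes "X \<in> carrier_mat n d" "0 < n" "vec_space.rank n X \<le> 1"
  obtains x y i where "i < n" "x i \<noteq> 0" "X = outer n d x y"
proof (cases "X = 0\<^sub>m n d")
  case True
  \<comment> \<open>The zero matrix puts the zero into \<open>y\<close>, keeping \<open>x\<close>
    nonzero; index 0 is available because \<open>0 < n\<close>.\<close>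
  then have "X = outer n d (\<lambda>_. 1) (\<lambda>_. 0)"
    by (auto simp: outer_def)
  then show ?thesis
    using that[of 0 "\<lambda>_. 1" "\<lambda>_. 0"] assms by simp
next
  case False
  then obtain i0 j0 where ij: "i0 < n" "j0 < d" "X $$ (i0, j0) \<noteq> 0"
    using assms(1) by (auto simp: mat_eq_iff)
  interpret vec_space "TYPE(real)" n .
  define v where "v = col X j0"
  have v: "v \<in> carrier_vec n" "v \<in> set (cols X)"
    using assms(1) ij by (auto simp: v_def cols_def)
  have vi: "vec_index v i0 = X $$ (i0, j0)"
    using ij assms(1) by (simp add: v_def)
  then have v0: "v \<noteq> 0\<^sub>v n"
    using ij by auto
  \<comment> \<open>Equal columns are split off because the set \<open>{col X j, v}\<close> would
    then have only one element and the rank bound would give no contradiction.\<close>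
  have "\<exists>c. col X j = c \<cdot>\<^sub>v v" if j: "j < d" for j
  proof (cases "col X j = v")
    case True
    then show ?thesis by (intro exI[of _ 1]) auto
  next
    case False
    have w: "col X j \<in> carrier_vec n" "col X j \<in> set (cols X)"
      using assms(1) j by (auto simp: cols_def)
    have "lin_dep {col X j, v}"
    proof (rule ccontr)
      assume "lin_indpt {col X j, v}"
      then have "card {col X j, v} \<le> rank X"
        using v(2) w(2) by (intro rank_ge_card_indpt[OF assms(1)]) simp_all
      then show False
        using False assms(3) by simp
    qed
    then have "col X j \<in> span {v}"
      using lin_dep_iff_in_span[of "{v}" "col X j"] lin_indpt_singleton[OF v(1) v0] v(1) w(1) False
      by simp
    then show ?thesis
      by (rule span_singletonE[OF _ v(1)]) blast
  qed
  then obtain y where y: "\<And>j. j < d \<Longrightarrow> col X j = y j \<cdot>\<^sub>v v"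
    by metis
  have "X $$ (i, j) = vec_index v i * y j" if "i < n" "j < d" for i j
    using arg_cong[OF y[OF that(2)], of "\<lambda>w. vec_index w i"] that assms(1) v by simp
  then have "X = outer n d (vec_index v) y"
    using assms(1) by (auto simp: outer_def)
  then show ?thesis
    using that[of i0 "vec_index v" y] ij vi by simp
qed

section \<open>Membership in the span of the sampled rows\<close>

text \<open>The list \<open>T\<close> is kept apart from \<open>S\<close> so that the induction can
  shrink it while the span stays fixed; this also covers the single row of the fallback
  matrix.\<close>

lemma sum_row_multiples_in_row_span:
  assumes "A \<in> carrier_mat n d" "set T \<subseteq> set S" "set S \<subseteq> {..<n}"
  shows "Matrix.vec d (\<lambda>j. \<Sum>k\<leftarrow>T. c k * A $$ (k, j)) \<in> row_span A S"
proof -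
  interpret vec_space "TYPE(real)" d .
  have dA: "dim_col A = d" using assms by auto
  have W: "Matrix.row A ` set S \<subseteq> carrier_vec d"
    using assms by auto
  show ?thesis
    using assms(2)
  proof (induction T)
    case Nil
    have "Matrix.vec d (\<lambda>j. \<Sum>k\<leftarrow>[]. c k * A $$ (k, j)) = 0\<^sub>v d" by auto
    then show ?case
      using vectorspace.span_zero[OF vectorspace_axioms] by (simp add: row_span_def dA)
  next
    case (Cons k T)
    have "c k \<cdot>\<^sub>v Matrix.row A k \<in> row_span A S"
      unfolding row_span_def dA using Cons.prems
      by (intro smult_in_span[OF W] subsetD[OF in_own_span[OF W]]) auto
    then have "c k \<cdot>\<^sub>v Matrix.row A k + Matrix.vec d (\<lambda>j. \<Sum>k\<leftarrow>T. c k * A $$ (k, j)) \<in> row_span A S"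
      using span_add1[OF W] Cons unfolding row_span_def dA by simp
    also have "c k \<cdot>\<^sub>v Matrix.row A k + Matrix.vec d (\<lambda>j. \<Sum>k\<leftarrow>T. c k * A $$ (k, j))
        = Matrix.vec d (\<lambda>j. \<Sum>k\<leftarrow>k # T. c k * A $$ (k, j))"
      using Cons.prems assms by (intro eq_vecI) auto
    finally show ?case .
  qed
qed

lemma rows_outer_in_row_span:
  assumes "A \<in> carrier_mat n d" "Matrix.vec d y \<in> row_span A S" "set S \<subseteq> {..<n}"
  shows "set (Matrix.rows (outer n d x y)) \<subseteq> row_span A S"
proof
  fix r assume "r \<in> set (Matrix.rows (outer n d x y))"
  then obtain i where i: "i < n" "r = Matrix.row (outer n d x y) i"
    by (auto simp: Matrix.rows_def outer_def)
  interpret vec_space "TYPE(real)" d .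
  have dA: "dim_col A = d" using assms by auto
  have W: "Matrix.row A ` set S \<subseteq> carrier_vec d"
    using assms by auto
  have "r = x i \<cdot>\<^sub>v Matrix.vec d y"
    using i by (auto simp: outer_def)
  then show "r \<in> row_span A S"
    using assms smult_in_span[OF W] unfolding row_span_def dA by simp
qed

section \<open>Least squares for a fixed left factor\<close>

text \<open>The hypothesis is the normal equation: in each column the residual at \<open>w\<close>
  is orthogonal to \<open>x\<close>, so the cross term of the expansion around \<open>w\<close>
  vanishes.\<close>

lemma least_squares_pythagoras:
  fixes x z w :: "nat \<Rightarrow> real" and a :: "nat \<Rightarrow> nat \<Rightarrow> real"
  assumes w: "\<And>j. (\<Sum>i<n. (x i)\<^sup>2) * w j = (\<Sum>i<n. x i * a i j)"
  shows "(\<Sum>i<n. \<Sum>j<d. (a i j - x i * z j)\<^sup>2) =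
    (\<Sum>i<n. \<Sum>j<d. (a i j - x i * w j)\<^sup>2) + (\<Sum>i<n. (x i)\<^sup>2) * (\<Sum>j<d. (z j - w j)\<^sup>2)"
proof -
  have "(\<Sum>i<n. (a i j - x i * z j)\<^sup>2) =
      (\<Sum>i<n. (a i j - x i * w j)\<^sup>2) + (\<Sum>i<n. (x i)\<^sup>2) * (z j - w j)\<^sup>2" for j
  proof -
    have "(\<Sum>i<n. (a i j - x i * z j)\<^sup>2) = (\<Sum>i<n. (a i j - x i * w j)\<^sup>2
        + (x i)\<^sup>2 * (z j - w j)\<^sup>2 - 2 * (z j - w j) * (x i * a i j - (x i)\<^sup>2 * w j))"
      by (intro sum.cong) (auto simp: power2_eq_square algebra_simps)
    also have "\<dots> = (\<Sum>i<n. (a i j - x i * w j)\<^sup>2) + (\<Sum>i<n. (x i)\<^sup>2) * (z j - w j)\<^sup>2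
        - 2 * (z j - w j) * ((\<Sum>i<n. x i * a i j) - (\<Sum>i<n. (x i)\<^sup>2) * w j)"
      by (simp add: sum.distrib sum_subtractf sum_distrib_right flip: sum_distrib_left)
    finally show ?thesis by (simp add: w)
  qed
  then show ?thesis
    by (subst (1 2) sum.swap) (simp add: sum.distrib sum_distrib_left)
qed

section \<open>Mean and variance of sums of independent draws\<close>

lemma finite_set_replicate_pmf: "finite (set_pmf p) \<Longrightarrow> finite (set_pmf (replicate_pmf s p))"
  by (induction s) auto

text \<open>Conditioning on the first draw. Finite support reduces the outer expectation to a finite
  sum.\<close>

lemma expectation_replicate_pmf_Suc:
  fixes f :: "'a list \<Rightarrow> real"
  assumes "finite (set_pmf p)"
  shows "measure_pmf.expectation (replicate_pmf (Suc s) p) f =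
    measure_pmf.expectation p (\<lambda>x. measure_pmf.expectation (replicate_pmf s p) (\<lambda>xs. f (x # xs)))"
proof -
  have "measure_pmf.expectation (replicate_pmf (Suc s) p) f =
      (\<Sum>x\<in>set_pmf p. pmf p x *\<^sub>R
        measure_pmf.expectation (map_pmf (Cons x) (replicate_pmf s p)) f)"
    unfolding replicate_pmf.simps map_pmf_def[symmetric] using assms
    by (subst pmf_expectation_bind[of "set_pmf p"]) (auto simp: finite_set_replicate_pmf)
  then show ?thesis
    using assms by (simp add: integral_measure_pmf[of "set_pmf p"])
qed

text \<open>Variances of independent draws add up. Both claims go through one induction, since the
  mixed term in the second vanishes by the first.\<close>

lemma variance_sum_list_replicate_pmf:
  fixes g :: "'a \<Rightarrow> real"
  assumes fin: "finite (set_pmf p)" and \<mu>: "\<mu> = measure_pmf.expectation p g"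
  shows "measure_pmf.expectation (replicate_pmf s p) (\<lambda>xs. (\<Sum>x\<leftarrow>xs. g x) - s * \<mu>) = 0"
    and "measure_pmf.expectation (replicate_pmf s p) (\<lambda>xs. ((\<Sum>x\<leftarrow>xs. g x) - s * \<mu>)\<^sup>2) =
      s * (measure_pmf.expectation p (\<lambda>x. (g x)\<^sup>2) - \<mu>\<^sup>2)"
proof (induction s)
  case 0
  {
    case 1
    show ?case by simp
  next
    case 2
    show ?case by simp
  }
next
  case (Suc s)
  note int = integrable_measure_pmf_finite[OF fin]
    integrable_measure_pmf_finite[OF finite_set_replicate_pmf[OF fin, of s]]
  let ?T = "\<lambda>xs. (\<Sum>x\<leftarrow>xs. g x) - s * \<mu>"
  {
    case 1
    have "measure_pmf.expectation (replicate_pmf s p) (\<lambda>xs. (g x - \<mu>) + ?T xs) = g x - \<mu>" for x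
      by (subst Bochner_Integration.integral_add) (use Suc.IH(1) int in auto)
    moreover have "(\<Sum>x\<leftarrow>x # xs. g x) - Suc s * \<mu> = (g x - \<mu>) + ?T xs" for x xs
      by (simp add: algebra_simps)
    moreover have "measure_pmf.expectation p (\<lambda>x. g x - \<mu>) = 0"
      by (subst Bochner_Integration.integral_diff) (use int \<mu> in auto)
    ultimately show ?case
      by (simp only: expectation_replicate_pmf_Suc[OF fin])
  next
    case 2
    \<comment> \<open>The first draw \<open>x\<close> is fixed here, so the mixed term is a constant
      times the mean of \<open>?T\<close>, which is 0. The rule \<open>integral_diff\<close> is
      disabled to keep that mean in the form of the induction hypothesis.\<close>
    have "measure_pmf.expectation (replicate_pmf s p)
        (\<lambda>xs. (g x - \<mu>)\<^sup>2 + (2 * (g x - \<mu>) * ?T xs + (?T xs)\<^sup>2)) = (g x - \<mu>)\<^sup>2 +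
        s * (measure_pmf.expectation p (\<lambda>x. (g x)\<^sup>2) - \<mu>\<^sup>2)" for x
      by (subst Bochner_Integration.integral_add, simp add: int, simp add: int,
          subst Bochner_Integration.integral_add, simp add: int, simp add: int)
        (simp add: Suc.IH del: Bochner_Integration.integral_diff)
    moreover have "((\<Sum>x\<leftarrow>x # xs. g x) - Suc s * \<mu>)\<^sup>2
        = (g x - \<mu>)\<^sup>2 + (2 * (g x - \<mu>) * ?T xs + (?T xs)\<^sup>2)" for x xs
      by (simp add: algebra_simps power2_eq_square)
    moreover have "measure_pmf.expectation p (\<lambda>x. (g x - \<mu>)\<^sup>2 + c)
        = c + measure_pmf.expectation p (\<lambda>x. (g x)\<^sup>2) - \<mu>\<^sup>2" for c
      using measure_pmf.variance_eq[of p g, OF int(1) int(1)]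
      by (subst Bochner_Integration.integral_add) (simp_all add: int \<mu>)
    ultimately show ?case
      by (simp only: expectation_replicate_pmf_Suc[OF fin]) (simp add: algebra_simps)
  }
qed

section \<open>Length-squared sampling\<close>

lemma set_length_squared_pmf:
  assumes "A \<in> carrier_mat n d" "A \<noteq> 0\<^sub>m n d" "k \<in> set_pmf (length_squared_pmf A)"
  shows "k < n" "vec_norm (Matrix.row A k) \<noteq> 0"
  using assms pmf_length_squared[OF assms(1,2), of k]
  by (auto simp: set_pmf_iff length_squared_prob_def split: if_splits)

lemma expectation_length_squared_pmf:
  fixes f :: "nat \<Rightarrow> real"
  assumes "A \<in> carrier_mat n d" "A \<noteq> 0\<^sub>m n d"
  shows "measure_pmf.expectation (length_squared_pmf A) f = (\<Sum>k<n. length_squared_prob A k * f k)"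
  using set_length_squared_pmf[OF assms]
  by (subst integral_measure_pmf[of "{..<n}"]) (auto simp: pmf_length_squared[OF assms])

text \<open>By Pythagoras the excess over the error of \<open>w\<close> is \<open>N\<close> times
  the squared distance from \<open>z S\<close> to \<open>w\<close>, and its expectation is a sum of
  coordinatewise variances.\<close>

lemma expectation_sampled_outer_error:
  fixes x :: "nat \<Rightarrow> real"
  assumes A: "A \<in> carrier_mat n d" "A \<noteq> 0\<^sub>m n d" and s: "s > 0"
  defines "N \<equiv> \<Sum>i<n. (x i)\<^sup>2"
  defines "z \<equiv> \<lambda>S j. (\<Sum>k\<leftarrow>S. x k / (N * length_squared_prob A k) * A $$ (k, j)) / real s"
    and "w \<equiv> \<lambda>j. (\<Sum>i<n. x i * A $$ (i, j)) / N"
  assumes N: "N > 0"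
  shows "measure_pmf.expectation (replicate_pmf s (length_squared_pmf A))
      (\<lambda>S. (frob_norm (A - outer n d x (z S)))\<^sup>2)
    \<le> (1 + 1 / real s) * (frob_norm (A - outer n d x w))\<^sup>2"
proof -
  let ?p = "length_squared_pmf A" and ?q = "length_squared_prob A"
  let ?E = "measure_pmf.expectation (replicate_pmf s ?p)"
  define \<delta> where "\<delta> = (frob_norm (A - outer n d x w))\<^sup>2"
  define F where "F = (frob_norm A)\<^sup>2"
  define g where "g = (\<lambda>j k. x k / (N * ?q k) * A $$ (k, j))"
  have Fpos: "F > 0"
    using frob_norm_sq_pos[OF A] by (simp add: F_def)
  have fin: "finite (set_pmf ?p)"
    using set_length_squared_pmf(1)[OF A] by (auto intro: finite_subset[of _ "{..<n}"])
  note int = integrable_measure_pmf_finite[OF finite_set_replicate_pmf[OF fin]]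
  have err: "(frob_norm (A - outer n d x y))\<^sup>2 = \<delta> + N * (\<Sum>j<d. (y j - w j)\<^sup>2)" for y
    unfolding \<delta>_def frob_norm_sq_minus_outer[OF A(1)] N_def
    by (rule least_squares_pythagoras) (use N in \<open>simp add: w_def flip: N_def\<close>)
  \<comment> \<open>Pythagoras at the zero vector; it later turns \<open>F / N\<close> minus the
    squared norm of \<open>w\<close> into \<open>\<delta> / N\<close>.\<close>
  have "F = (frob_norm (A - outer n d x (\<lambda>_. 0)))\<^sup>2"
    using A(1) by (simp add: F_def frob_norm_sq_minus_outer[OF A(1)] frob_norm_sq[of A])
  then have F: "F = \<delta> + N * (\<Sum>j<d. (w j)\<^sup>2)"
    by (simp add: err)
  have row: "(\<Sum>j<d. (A $$ (k, j))\<^sup>2) = F * ?q k" if "k < n" for k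
    using A(1) Fpos that by (auto simp: length_squared_prob_def vec_norm_sq F_def)
  \<comment> \<open>A row of probability 0 is a zero row, so the quotient by \<open>?q k\<close> in
    \<open>g\<close>, which then defaults to 0, loses nothing and \<open>g j\<close> is
    unbiased.\<close>
  have zero: "A $$ (k, j) = 0" if "?q k = 0" "k < n" "j < d" for k j
    using row[OF that(2)] that by (simp add: sum_nonneg_eq_0_iff)
  have mean: "w j = measure_pmf.expectation ?p (g j)" if "j < d" for j
    unfolding expectation_length_squared_pmf[OF A] w_def sum_divide_distrib g_def
    using zero[OF _ _ that] by (intro sum.cong) auto
  have "(\<Sum>j<d. measure_pmf.expectation ?p (\<lambda>k. (g j k)\<^sup>2)) = (\<Sum>k<n. \<Sum>j<d. ?q k * (g j k)\<^sup>2)"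
    unfolding expectation_length_squared_pmf[OF A] by (rule sum.swap)
  \<comment> \<open>The weight \<open>?q k\<close> cancels one factor of the squared denominator and
    the row norm \<open>F * ?q k\<close> the other. Only an inequality holds, since an index with
    \<open>?q k = 0\<close> contributes 0 on the left.\<close>
  also have "\<dots> \<le> (\<Sum>k<n. F * (x k)\<^sup>2 / N\<^sup>2)"
  proof (rule sum_mono)
    fix k assume "k \<in> {..<n}"
    then have k: "k < n" by simp
    have "(\<Sum>j<d. ?q k * (g j k)\<^sup>2) = ?q k * (x k / (N * ?q k))\<^sup>2 * (\<Sum>j<d. (A $$ (k, j))\<^sup>2)"
      unfolding g_def power_mult_distrib sum_distrib_left by (simp only: mult_ac)
    also have "\<dots> \<le> F * (x k)\<^sup>2 / N\<^sup>2"
      unfolding row[OF k] using Fpos N by (cases "?q k = 0") (auto simp: field_simps power2_eq_square)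
    finally show "(\<Sum>j<d. ?q k * (g j k)\<^sup>2) \<le> F * (x k)\<^sup>2 / N\<^sup>2" .
  qed
  also have "\<dots> = F / N"
    using N by (simp add: N_def power2_eq_square flip: sum_divide_distrib sum_distrib_left)
  finally have second: "(\<Sum>j<d. measure_pmf.expectation ?p (\<lambda>k. (g j k)\<^sup>2)) \<le> F / N" .
  have var: "?E (\<lambda>S. (z S j - w j)\<^sup>2) =
      (measure_pmf.expectation ?p (\<lambda>k. (g j k)\<^sup>2) - (w j)\<^sup>2) / s" if j: "j < d" for j
  proof -
    \<comment> \<open>The variance of the sum is \<open>s\<close> times that of one draw; dividing
      by \<open>s\<^sup>2\<close> leaves the factor \<open>1 / s\<close>.\<close>
    have "(z S j - w j)\<^sup>2 = ((\<Sum>k\<leftarrow>S. g j k) - s * w j)\<^sup>2 / s\<^sup>2" for S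
      using s by (simp add: z_def g_def field_simps flip: power_divide)
    then show ?thesis
      using variance_sum_list_replicate_pmf(2)[OF fin mean[OF j], of s] s
      by (simp add: power2_eq_square)
  qed
  have "?E (\<lambda>S. (frob_norm (A - outer n d x (z S)))\<^sup>2)
      = ?E (\<lambda>S. \<delta> + N * (\<Sum>j<d. (z S j - w j)\<^sup>2))"
    by (simp only: err)
  also have "\<dots> = \<delta> + N * (\<Sum>j<d. ?E (\<lambda>S. (z S j - w j)\<^sup>2))"
    by (subst Bochner_Integration.integral_add)
      (simp_all add: int Bochner_Integration.integral_sum)
  also have "\<dots> = \<delta> + N / s *
      ((\<Sum>j<d. measure_pmf.expectation ?p (\<lambda>k. (g j k)\<^sup>2)) - (\<Sum>j<d. (w j)\<^sup>2))"
    by (simp add: var flip: sum_divide_distrib sum_subtractf)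
  also have "\<dots> \<le> \<delta> + N / s * (F / N - (\<Sum>j<d. (w j)\<^sup>2))"
    using second N by (intro add_left_mono mult_left_mono) auto
  also have "\<dots> = (1 + 1 / s) * \<delta>"
    using N s by (simp add: F field_simps)
  finally show ?thesis by (simp add: \<delta>_def)
qed

section \<open>Rank repair and the final estimate\<close>

text \<open>Subtracting this matrix clears row \<open>k\<close> and leaves the other rows
  alone.\<close>

lemma frob_norm_sq_minus_single_row_le:
  assumes "A \<in> carrier_mat n d"
  shows "(frob_norm (A - outer n d (\<lambda>i. if i = k then 1 else 0) (\<lambda>j. A $$ (k, j))))\<^sup>2
    \<le> (frob_norm A)\<^sup>2"
  unfolding frob_norm_sq_minus_outer[OF assms] frob_norm_sq[of A]
  using assms by (auto intro!: sum_mono)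

theorem theorem2:
  shows "\<exists>C::real. C > 0 \<and>
    (\<forall>(\<epsilon>::real) (n::nat) (d::nat) (A::real mat) (\<pi>\<^sub>1A::real mat) (s::nat).
      0 < \<epsilon> \<longrightarrow> \<epsilon> < 1 \<longrightarrow>
      A \<in> carrier_mat n d \<longrightarrow> A \<noteq> 0\<^sub>m n d \<longrightarrow>
      best_rank1_approx A \<pi>\<^sub>1A \<longrightarrow>
      real s \<ge> C / \<epsilon> ^ 4 \<longrightarrow>
      (\<exists>At :: nat list \<Rightarrow> real mat.
        (\<forall>S \<in> set_pmf (replicate_pmf s (length_squared_pmf A)).
           At S \<in> carrier_mat n d \<and>
           vec_space.rank n (At S) = 1 \<and>
           set (Matrix.rows (At S)) \<subseteq> row_span A S) \<and>
        measure_pmf.expectation (replicate_pmf s (length_squared_pmf A))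
            (\<lambda>S. (frob_norm (A - At S))\<^sup>2)
          \<le> (1 + \<epsilon>) * (frob_norm (A - \<pi>\<^sub>1A))\<^sup>2))"
\<comment> \<open>The constant 1 suffices: \<open>s \<ge> 1 / \<epsilon> ^ 4\<close> gives
  \<open>1 / s \<le> \<epsilon> ^ 4 \<le> \<epsilon>\<close>, and sampling costs a factor
  \<open>1 + 1 / s\<close>.\<close>
proof (rule exI[of _ 1], intro conjI allI impI)
  show "(0::real) < 1" by simp
next
  fix \<epsilon> :: real and n d :: nat and A \<pi>\<^sub>1A :: "real mat" and s :: nat
  assume \<epsilon>: "0 < \<epsilon>" "\<epsilon> < 1" and A: "A \<in> carrier_mat n d" "A \<noteq> 0\<^sub>m n d"
    and best: "best_rank1_approx A \<pi>\<^sub>1A" and s_ge: "real s \<ge> 1 / \<epsilon> ^ 4"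
  let ?p = "length_squared_pmf A" and ?q = "length_squared_prob A"
  have s0: "s > 0"
    using s_ge \<epsilon> by (cases "s = 0") (auto simp: field_simps)
  have "1 / real s \<le> \<epsilon> ^ 4"
    using s_ge \<epsilon> s0 by (simp add: field_simps)
  also have "\<dots> \<le> \<epsilon>"
    using power_decreasing[of 1 4 \<epsilon>] \<epsilon> by simp
  finally have s_inv: "1 / real s \<le> \<epsilon>" .
  have "0 < n"
    using A by (cases n) (auto simp: mat_eq_iff)
  moreover have "\<pi>\<^sub>1A \<in> carrier_mat n d" "vec_space.rank n \<pi>\<^sub>1A \<le> 1"
    using best A(1) by (auto simp: best_rank1_approx_def is_arg_min_def)
  ultimately obtain x y i0 where x: "i0 < n" "x i0 \<noteq> 0" and pi: "\<pi>\<^sub>1A = outer n d x y"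
    using rank_le_oneE by metis
  define N where "N = (\<Sum>i<n. (x i)\<^sup>2)"
  have N: "N > 0"
    unfolding N_def using x by (intro sum_pos2[of _ i0]) auto
  define w where "w = (\<lambda>j. (\<Sum>i<n. x i * A $$ (i, j)) / N)"
  define z where "z = (\<lambda>S j. (\<Sum>k\<leftarrow>S. x k / (N * ?q k) * A $$ (k, j)) / real s)"
  \<comment> \<open>If \<open>z S\<close> vanishes, its outer product is the zero matrix; the
    fallback copies the first sampled row into its own position, which gives rank exactly 1.\<close>
  define At where "At = (\<lambda>S. if \<exists>j<d. z S j \<noteq> 0 then outer n d x (z S)
    else outer n d (\<lambda>i. if i = hd S then 1 else 0) (\<lambda>j. A $$ (hd S, j)))"
  \<comment> \<open>With the left factor \<open>x\<close> of \<open>\<pi>\<^sub>1A\<close> fixed,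
    \<open>w\<close> is the optimal right factor, so it does at least as well as
    \<open>y\<close>.\<close>
  have "(frob_norm (A - outer n d x w))\<^sup>2 + N * (\<Sum>j<d. (y j - w j)\<^sup>2) = (frob_norm (A - \<pi>\<^sub>1A))\<^sup>2"
    unfolding pi frob_norm_sq_minus_outer[OF A(1)] N_def
    by (rule least_squares_pythagoras[symmetric]) (use N in \<open>simp add: w_def flip: N_def\<close>)
  moreover have "N * (\<Sum>j<d. (y j - w j)\<^sup>2) \<ge> 0"
    using N by (simp add: sum_nonneg)
  ultimately have w_best: "(frob_norm (A - outer n d x w))\<^sup>2 \<le> (frob_norm (A - \<pi>\<^sub>1A))\<^sup>2"
    by linarith
  \<comment> \<open>The comparison holds for every sample, so the bound on the expectation for
    \<open>z S\<close> carries over to \<open>At\<close> by monotonicity.\<close>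
  have At_le: "(frob_norm (A - At S))\<^sup>2 \<le> (frob_norm (A - outer n d x (z S)))\<^sup>2" for S
  proof (cases "\<exists>j<d. z S j \<noteq> 0")
    case False
    then have "(frob_norm (A - outer n d x (z S)))\<^sup>2 = (frob_norm A)\<^sup>2"
      unfolding frob_norm_sq_minus_outer[OF A(1)] frob_norm_sq[of A] using A(1) by simp
    with False show ?thesis
      using frob_norm_sq_minus_single_row_le[OF A(1)] by (simp add: At_def)
  qed (simp add: At_def)
  have "At S \<in> carrier_mat n d \<and> vec_space.rank n (At S) = 1 \<and>
      set (Matrix.rows (At S)) \<subseteq> row_span A S"
    if S: "S \<in> set_pmf (replicate_pmf s ?p)" for S
  proof -
    have sub: "set S \<subseteq> set_pmf ?p" and len: "length S = s"
      using S by (auto simp: set_replicate_pmf)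
    have Sn: "set S \<subseteq> {..<n}"
      using sub set_length_squared_pmf(1)[OF A] by auto
    show ?thesis
    proof (cases "\<exists>j<d. z S j \<noteq> 0")
      case True
      \<comment> \<open>The averaging factor \<open>1 / s\<close> is absorbed into the coefficients,
        to exhibit \<open>z S\<close> as a plain combination of sampled rows.\<close>
      have "Matrix.vec d (z S) = Matrix.vec d (\<lambda>j. \<Sum>k\<leftarrow>S. x k / (N * ?q k * s) * A $$ (k, j))"
        by (simp add: z_def divide_inverse mult_ac flip: sum_list_const_mult)
      then have "Matrix.vec d (z S) \<in> row_span A S"
        using sum_row_multiples_in_row_span[OF A(1) order.refl Sn] by (simp only:)
      then show ?thesis
        using True x rank_eq_one_outer rows_outer_in_row_span[OF A(1) _ Sn] by (auto simp: At_def)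
    next
      case False
      \<comment> \<open>The sample is nonempty because \<open>s > 0\<close>, so its head is a
        genuine draw; rows in the support are nonzero.\<close>
      have hd: "hd S \<in> set S"
        using len s0 by (intro hd_in_set) auto
      have hdn: "hd S < n" using hd Sn by auto
      have "\<exists>j<d. A $$ (hd S, j) \<noteq> 0"
      proof (rule ccontr)
        assume "\<not> ?thesis"
        then have "vec_norm (Matrix.row A (hd S)) = 0"
          using A(1) hdn by (simp add: vec_norm_def)
        then show False
          using set_length_squared_pmf(2)[OF A] hd sub by auto
      qed
      moreover have "Matrix.vec d (\<lambda>j. A $$ (hd S, j)) \<in> row_span A S"
        using sum_row_multiples_in_row_span[OF A(1) _ Sn, of "[hd S]" "\<lambda>_. 1"] hd by simp
      ultimately show ?thesis
        using False hdn rank_eq_one_outer[of "hd S" n "\<lambda>i. if i = hd S then 1 else 0"]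
          rows_outer_in_row_span[OF A(1) _ Sn] by (auto simp: At_def)
    qed
  qed
  moreover have "measure_pmf.expectation (replicate_pmf s ?p) (\<lambda>S. (frob_norm (A - At S))\<^sup>2)
      \<le> (1 + \<epsilon>) * (frob_norm (A - \<pi>\<^sub>1A))\<^sup>2"
  proof -
    have fin: "finite (set_pmf ?p)"
      using set_length_squared_pmf(1)[OF A] by (auto intro: finite_subset[of _ "{..<n}"])
    note int = integrable_measure_pmf_finite[OF finite_set_replicate_pmf[OF fin]]
    have "measure_pmf.expectation (replicate_pmf s ?p) (\<lambda>S. (frob_norm (A - At S))\<^sup>2)
        \<le> measure_pmf.expectation (replicate_pmf s ?p) (\<lambda>S. (frob_norm (A - outer n d x (z S)))\<^sup>2)"
      by (intro integral_mono int At_le)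
    also have "\<dots> \<le> (1 + 1 / real s) * (frob_norm (A - outer n d x w))\<^sup>2"
      unfolding z_def w_def N_def
      by (rule expectation_sampled_outer_error[OF A s0]) (use N in \<open>simp add: N_def\<close>)
    also have "\<dots> \<le> (1 + \<epsilon>) * (frob_norm (A - \<pi>\<^sub>1A))\<^sup>2"
      using s_inv w_best \<epsilon> by (intro mult_mono) auto
    finally show ?thesis .
  qed
  ultimately show "\<exists>At :: nat list \<Rightarrow> real mat.
        (\<forall>S \<in> set_pmf (replicate_pmf s ?p).
           At S \<in> carrier_mat n d \<and>
           vec_space.rank n (At S) = 1 \<and>
           set (Matrix.rows (At S)) \<subseteq> row_span A S) \<and>
        measure_pmf.expectation (replicate_pmf s ?p) (\<lambda>S. (frob_norm (A - At S))\<^sup>2)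
          \<le> (1 + \<epsilon>) * (frob_norm (A - \<pi>\<^sub>1A))\<^sup>2"
    by blast
qed

end
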